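(* Let $\varepsilon>0$ and let $G=(V,E)$ be the complete graph on $n=|V|$ nodes. There exists an $\varepsilon$-augmented cut sparsifier for $G$ with $O(n)$ nodes and $O\big(n\varepsilon^{-1/2}\log\log\frac{1}{\varepsilon}\big)$ edges.
   Context: For an undirected graph $G=(V,E)$ (here with unit edge weights), $\mathbf{cut}_G(S)$ is the number (total weight) of edges with exactly one endpoint in $S$. For a directed graph $\hat G=(V\cup\mathcal{A},\hat E)$ with nonnegative edge weights, where $\mathcal{A}$ is a set of auxiliary nodes disjoint from $V$, let $\mathbf{dircut}_{\hat G}(U)$ be the total weight of edges directed from $U$ to its complement, and $\mathbf{cut}_{\hat G}(S)=\min_{T\subseteq\mathcal{A}}\mathbf{dircut}_{\hat G}(S\cup T)$ for $S\subseteq V$. $\hat G$ is an $\varepsilon$-augmented cut sparsifier for $G$ if $\mathbf{cut}_G(S)\le\mathbf{cut}_{\hat G}(S)\le(1+\varepsilon)\mathbf{cut}_G(S)$ for all $S\subseteq V$. Asymptotic notation in $\varepsilon$ refers to the regime $\varepsilon\to 0$. *)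

theory Defs
  imports "HOL-Analysis.Analysis" "Graph_Theory.Graph_Theory"
begin

text \<open>
  As in the graph library, an undirected simple graph is a symmetric digraph, so an edge joining
  u and v is present as the two arcs (u,v) and (v,u). Passing to the set {u,v} makes
  every undirected edge count once.
\<close>

definition undirected_cut :: "'a pair_pre_digraph \<Rightarrow> 'a set \<Rightarrow> nat" where
  "undirected_cut G S = card {{u, v} | u v. (u, v) \<in> parcs G \<and> (u \<in> S \<longleftrightarrow> v \<notin> S)}"

definition dircut :: "'a pair_pre_digraph \<Rightarrow> ('a \<times> 'a) weight_fun \<Rightarrow> 'a set \<Rightarrow> real" where
  "dircut H w U = (\<Sum>e\<in>{e \<in> parcs H. fst e \<in> U \<and> snd e \<notin> U}. w e)"

text \<open>
  Nodes of an augmented digraph live in a disjoint sum: the original nodes carry the tag Inl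
  and the auxiliary ones, which form an arbitrary finite set of naturals, the tag Inr.
\<close>

definition augmented_cut ::
  "nat set \<Rightarrow> ('a + nat) pair_pre_digraph \<Rightarrow> (('a + nat) \<times> ('a + nat)) weight_fun \<Rightarrow> 'a set \<Rightarrow> real"
  where "augmented_cut A H w S = (MIN T\<in>Pow A. dircut H w (S <+> T))"

definition augmented_cut_sparsifier ::
  "real \<Rightarrow> 'a pair_pre_digraph \<Rightarrow> nat set \<Rightarrow> ('a + nat) pair_pre_digraph
    \<Rightarrow> (('a + nat) \<times> ('a + nat)) weight_fun \<Rightarrow> bool"
  where "augmented_cut_sparsifier \<epsilon> G A H w \<longleftrightarrow>
    pair_digraph H \<and> pverts H = pverts G <+> A \<and> (\<forall>e\<in>parcs H. 0 \<le> w e) \<and>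
    (\<forall>S. S \<subseteq> pverts G \<longrightarrow>
       real (undirected_cut G S) \<le> augmented_cut A H w S \<and>
       augmented_cut A H w S \<le> (1 + \<epsilon>) * real (undirected_cut G S))"

end

theory Submission
  imports Defs
begin

text \<open>
  The cut function of the complete graph is \<open>k (n - k)\<close> with \<open>k = |S|\<close>. An auxiliary node that
  receives weight \<open>\<alpha>\<close> from and sends weight \<open>\<beta>\<close> to every original node contributes
  \<open>min (\<alpha> k) (\<beta> (n - k))\<close> to the cut, and two such nodes with mirrored weights contribute a
  multiple of \<open>min \<kappa> s\<close>, where \<open>\<kappa> = min k (n - k)\<close>. It remains to approximate
  \<open>\<kappa> (n - \<kappa>)\<close> on \<open>[0, n/2]\<close> by a sum of such functions. The minimum of the tangents at points
  \<open>z\<^sub>0 = 0 < \<dots> < z\<^sub>m = n/2\<close> is one, the kinks \<open>s\<close> being the midpoints of consecutive \<open>z\<^sub>i\<close>, and its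
  absolute error is at most the squared distance to the nearest \<open>z\<^sub>i\<close>. With the quadratic spacing
  \<open>z\<^sub>i = (n/2) (i/m)\<^sup>2\<close> the relative error is \<open>O(1/m\<^sup>2)\<close>, so \<open>m = O(\<epsilon> powr (-1/2))\<close> pairs of
  auxiliary nodes suffice, even without the double logarithm. If this \<open>m\<close> exceeds \<open>n\<close>,
  the complete graph itself is small enough.
\<close>

section \<open>Cuts of complete graphs and of bipartite gadgets\<close>

lemma undirected_cut_complete_digraph:
  assumes "complete_digraph n (with_proj G)" "S \<subseteq> pverts G"
  shows "undirected_cut G S = card S * (n - card S)"
proof -
  from assms have G: "finite (pverts G)" "card (pverts G) = n"
    "parcs G = {(u,v). (u,v) \<in> pverts G \<times> pverts G \<and> u \<noteq> v}"
    by (auto simp: complete_digraph_pair_def)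
  have "{{u, v} | u v. (u, v) \<in> parcs G \<and> (u \<in> S \<longleftrightarrow> v \<notin> S)}
      = (\<lambda>(u, v). {u, v}) ` (S \<times> (pverts G - S))" (is "?L = ?R")
  proof (intro equalityI subsetI)
    fix x assume "x \<in> ?L"
    then obtain u v where uv: "x = {u, v}" "u \<in> pverts G" "v \<in> pverts G" "u \<in> S \<longleftrightarrow> v \<notin> S"
      using G(3) by auto
    show "x \<in> ?R"
    proof (cases "u \<in> S")
      case True
      then show ?thesis using uv by (intro image_eqI[of _ _ "(u, v)"]) auto
    next
      case False
      then show ?thesis using uv by (intro image_eqI[of _ _ "(v, u)"]) auto
    qed
  next
    fix x assume "x \<in> ?R"
    then obtain u v where "x = {u, v}" "u \<in> S" "v \<in> pverts G - S" by auto
    then show "x \<in> ?L" using G(3) assms(2) by blast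
  qed
  moreover have "inj_on (\<lambda>(u, v). {u, v}) (S \<times> (pverts G - S))"
    by (auto simp: inj_on_def doubleton_eq_iff)
  moreover have "card (pverts G - S) = n - card S"
    using G assms(2) by (simp add: card_Diff_subset finite_subset)
  ultimately show ?thesis
    by (simp add: undirected_cut_def card_image card_cartesian_product)
qed

section \<open>Star gadgets around auxiliary nodes and their cuts\<close>

definition star_digraph :: "'a set \<Rightarrow> nat set \<Rightarrow> ('a + nat) pair_pre_digraph" where
  "star_digraph V A = \<lparr> pverts = V <+> A, parcs = Inl ` V \<times> Inr ` A \<union> Inr ` A \<times> Inl ` V \<rparr>"

text \<open>Weights depend only on the auxiliary node and the direction of the arc, so cuts see
  \<open>S\<close> only through its size. The value 0 is a default for pairs that are never arcs of
  \<open>star_digraph\<close>.\<close>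

definition star_weight ::
    "(nat \<Rightarrow> real) \<Rightarrow> (nat \<Rightarrow> real) \<Rightarrow> (('a + nat) \<times> ('a + nat)) weight_fun" where
  "star_weight \<alpha> \<beta> e =
     (case e of (Inl _, Inr j) \<Rightarrow> \<alpha> j | (Inr j, Inl _) \<Rightarrow> \<beta> j | _ \<Rightarrow> 0)"

lemma pair_digraph_star_digraph:
  "finite V \<Longrightarrow> finite A \<Longrightarrow> pair_digraph (star_digraph V A)"
  by unfold_locales (auto simp: star_digraph_def)

lemma card_pverts_star_digraph:
  "finite V \<Longrightarrow> finite A \<Longrightarrow> card (pverts (star_digraph V A)) = card V + card A"
  by (simp add: star_digraph_def card_Plus)

lemma card_parcs_star_digraph:
  assumes "finite V" "finite A"
  shows "card (parcs (star_digraph V A)) = 2 * card V * card A"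
proof -
  have "card (Inl ` V \<times> Inr ` A \<union> Inr ` A \<times> Inl ` V :: (('a + nat) \<times> ('a + nat)) set)
      = card V * card A + card A * card V"
    using assms by (subst card_Un_disjoint) (auto simp: card_cartesian_product card_image)
  then show ?thesis by (simp add: star_digraph_def)
qed

text \<open>Every arc has exactly one auxiliary endpoint, so the cut splits by auxiliary node:
  \<open>j\<close> in \<open>T\<close> pays for its arcs into \<open>V - S\<close>, any other
  \<open>j\<close> for its arcs from \<open>S\<close>.\<close>

lemma dircut_star_digraph:
  assumes "finite V" "finite A" "S \<subseteq> V" "T \<subseteq> A"
  shows "dircut (star_digraph V A) (star_weight \<alpha> \<beta>) (S <+> T)
    = (\<Sum>j\<in>A. if j \<in> T then \<beta> j * real (card (V - S)) else \<alpha> j * real (card S))"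
proof -
  have fin: "finite S" "finite T" using assms finite_subset by auto
  have "{e \<in> parcs (star_digraph V A). fst e \<in> S <+> T \<and> snd e \<notin> S <+> T}
      = Inl ` S \<times> Inr ` (A - T) \<union> Inr ` T \<times> Inl ` (V - S)"
    using assms by (auto simp: star_digraph_def)
  then have "dircut (star_digraph V A) (star_weight \<alpha> \<beta>) (S <+> T)
      = (\<Sum>e\<in>Inl ` S \<times> Inr ` (A - T). star_weight \<alpha> \<beta> e)
        + (\<Sum>e\<in>Inr ` T \<times> Inl ` (V - S). star_weight \<alpha> \<beta> e)"
    using assms fin by (simp add: dircut_def) (subst sum.union_disjoint, auto)
  also have "(\<Sum>e\<in>Inl ` S \<times> Inr ` (A - T). star_weight \<alpha> \<beta> e)
      = (\<Sum>j\<in>A - T. \<alpha> j * real (card S))"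
    by (simp add: sum.cartesian_product' sum.reindex star_weight_def sum_distrib_left mult.commute)
  also have "(\<Sum>e\<in>Inr ` T \<times> Inl ` (V - S). star_weight \<alpha> \<beta> e)
      = (\<Sum>j\<in>T. \<beta> j * real (card (V - S)))"
    by (simp add: sum.cartesian_product' sum.reindex star_weight_def mult.commute)
  also have "(\<Sum>j\<in>A - T. \<alpha> j * real (card S)) + (\<Sum>j\<in>T. \<beta> j * real (card (V - S)))
      = (\<Sum>j\<in>A. if j \<in> T then \<beta> j * real (card (V - S)) else \<alpha> j * real (card S))"
    using assms by (simp add: sum.If_cases Int_absorb1 Diff_eq Int_commute)
  finally show ?thesis .
qed

lemma augmented_cut_star_digraph:
  assumes "finite V" "finite A" "S \<subseteq> V"
  shows "augmented_cut A (star_digraph V A) (star_weight \<alpha> \<beta>) S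
    = (\<Sum>j\<in>A. min (\<alpha> j * real (card S)) (\<beta> j * real (card (V - S))))"
  unfolding augmented_cut_def
proof (rule Min_eqI)
  show "finite ((\<lambda>T. dircut (star_digraph V A) (star_weight \<alpha> \<beta>) (S <+> T)) ` Pow A)"
    using assms by simp
next
  fix y
  assume "y \<in> (\<lambda>T. dircut (star_digraph V A) (star_weight \<alpha> \<beta>) (S <+> T)) ` Pow A"
  then obtain T where "T \<subseteq> A" "y = dircut (star_digraph V A) (star_weight \<alpha> \<beta>) (S <+> T)"
    by auto
  then show "(\<Sum>j\<in>A. min (\<alpha> j * real (card S)) (\<beta> j * real (card (V - S)))) \<le> y"
    using assms by (auto simp: dircut_star_digraph intro!: sum_mono)
next
  \<comment> \<open>The contributions of the auxiliary nodes are independent, so the minimum is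
    reached by choosing the cheaper side for each node separately.\<close>
  let ?T = "{j \<in> A. \<beta> j * real (card (V - S)) \<le> \<alpha> j * real (card S)}"
  have "dircut (star_digraph V A) (star_weight \<alpha> \<beta>) (S <+> ?T)
      = (\<Sum>j\<in>A. min (\<alpha> j * real (card S)) (\<beta> j * real (card (V - S))))"
    using assms by (subst dircut_star_digraph) (auto intro!: sum.cong)
  then show "(\<Sum>j\<in>A. min (\<alpha> j * real (card S)) (\<beta> j * real (card (V - S))))
      \<in> (\<lambda>T. dircut (star_digraph V A) (star_weight \<alpha> \<beta>) (S <+> T)) ` Pow A"
    by (intro image_eqI[of _ _ ?T]) auto
qed

section \<open>Piecewise linear approximation of a parabola\<close>

text \<open>As functions of \<open>k\<close>, the two minima are tents with peaks at
  \<open>s\<close> and \<open>n - s\<close>. Written as \<open>n * min k s - s * k\<close> and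
  \<open>s * k - n * max 0 (k + s - n)\<close>, they lose their \<open>s * k\<close> terms in the
  sum; a trapezoid remains, because \<open>s \<le> n / 2\<close> puts the peaks in order.\<close>

lemma min_mirrored_tents:
  fixes k n s :: real
  assumes "0 \<le> k" "k \<le> n" "0 \<le> s" "s \<le> n / 2"
  shows "min ((n - s) * k) (s * (n - k)) + min (s * k) ((n - s) * (n - k))
    = n * min (min k (n - k)) s"
proof -
  have 1: "min ((n - s) * k) (s * (n - k)) = n * min k s - s * k"
    using assms by (simp add: min_mult_distrib_left min_diff_distrib_left algebra_simps)
  have eq: "s * k - (n - s) * (n - k) = n * (k + s - n)" by algebra
  have 2: "min (s * k) ((n - s) * (n - k)) = s * k - n * max 0 (k + s - n)"
  proof (cases "k + s \<le> n")
    case True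
    then have "n * (k + s - n) \<le> 0" "max 0 (k + s - n) = 0"
      using assms by (auto intro: mult_nonneg_nonpos)
    then show ?thesis using eq by simp
  next
    case False
    then have "0 \<le> n * (k + s - n)" "max 0 (k + s - n) = k + s - n"
      using assms by auto
    then show ?thesis using eq by simp
  qed
  have "n * min k s - n * max 0 (k + s - n) = n * (min k s - max 0 (k + s - n))"
    by (simp add: right_diff_distrib)
  also have "min k s - max 0 (k + s - n) = min (min k (n - k)) s"
    using assms by (auto simp: min_def max_def)
  finally show ?thesis using 1 2 by simp
qed

text \<open>
  \<open>tangent_sum z m c\<close> integrates the function \<open>2 min c s\<close> over \<open>[z 0, z m]\<close> by the midpoint rule,
  whereas \<open>kink_integral c t\<close> is its exact integral over \<open>[0, t]\<close>. The rule is exact on every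
  subinterval that does not contain \<open>c\<close>, and by concavity it never underestimates.
\<close>

definition tangent_sum :: "(nat \<Rightarrow> real) \<Rightarrow> nat \<Rightarrow> real \<Rightarrow> real" where
  "tangent_sum z m c = (\<Sum>j<m. 2 * (z (Suc j) - z j) * min c ((z j + z (Suc j)) / 2))"

definition kink_integral :: "real \<Rightarrow> real \<Rightarrow> real" where
  "kink_integral c t = (if t \<le> c then t\<^sup>2 else 2 * c * t - c\<^sup>2)"

lemma midpoint_rule_eq_min:
  fixes a b c :: real
  assumes "a \<le> b"
  shows "2 * (b - a) * min c ((a + b) / 2) = min (2 * (b - a) * c) (b\<^sup>2 - a\<^sup>2)"
proof -
  have "0 \<le> 2 * (b - a)" using assms by simp
  then have "2 * (b - a) * min c ((a + b) / 2)
      = min (2 * (b - a) * c) (2 * (b - a) * ((a + b) / 2))"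
    by (simp only: min_mult_distrib_left if_True)
  also have "2 * (b - a) * ((a + b) / 2) = b\<^sup>2 - a\<^sup>2"
    by (simp add: power2_eq_square field_simps)
  finally show ?thesis .
qed

text \<open>On such a cell the integrand is affine. The condition leaves out exactly the half-open
  case \<open>a \<le> c\<close>, \<open>c < b\<close>, so on a monotone grid at most one cell is
  inexact.\<close>

lemma midpoint_rule_exact:
  assumes "a \<le> b" "b \<le> c \<or> c < a"
  shows "2 * (b - a) * min c ((a + b) / 2) = kink_integral c b - kink_integral c a"
proof (cases "b \<le> c")
  case True
  then have "min c ((a + b) / 2) = (a + b) / 2" using assms by simp
  then have "2 * (b - a) * min c ((a + b) / 2) = b\<^sup>2 - a\<^sup>2"
    by (simp add: power2_eq_square field_simps)
  then show ?thesis using True assms by (simp add: kink_integral_def)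
next
  case False
  then have "min c ((a + b) / 2) = c" using assms by simp
  then show ?thesis using False assms by (simp add: kink_integral_def algebra_simps)
qed

lemma midpoint_rule_ge:
  assumes "a \<le> b"
  shows "kink_integral c b - kink_integral c a \<le> 2 * (b - a) * min c ((a + b) / 2)"
proof (cases "b \<le> c \<or> c < a")
  case True
  then show ?thesis using midpoint_rule_exact[OF assms] by simp
next
  case False
  \<comment> \<open>These squares are the excesses of the two branches of the minimum over the exact
    integral when \<open>c\<close> lies inside the cell.\<close>
  have "0 \<le> (c - a)\<^sup>2" "0 \<le> (b - c)\<^sup>2" by simp_all
  then show ?thesis
    unfolding midpoint_rule_eq_min[OF assms] kink_integral_def using False
    by (auto simp: power2_eq_square algebra_simps)
qed

text \<open>The error is the squared distance from \<open>c\<close> to the nearer endpoint, which is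
  at most half the cell width away. The distance to \<open>a\<close> is kept as well, for the first
  cell of the grid.\<close>

lemma midpoint_rule_le:
  assumes "a \<le> c" "c < b"
  shows "2 * (b - a) * min c ((a + b) / 2)
    \<le> kink_integral c b - kink_integral c a + min ((c - a)\<^sup>2) (((b - a) / 2)\<^sup>2)"
proof -
  have *: "2 * (b - a) * min c ((a + b) / 2) = min (2 * (b - a) * c) (b\<^sup>2 - a\<^sup>2)"
    using assms by (intro midpoint_rule_eq_min) simp
  have k: "kink_integral c b - kink_integral c a = 2 * c * b - c\<^sup>2 - a\<^sup>2"
    using assms by (auto simp: kink_integral_def power2_eq_square)
  have "2 * (b - a) * c = 2 * c * b - c\<^sup>2 - a\<^sup>2 + (c - a)\<^sup>2"
    "b\<^sup>2 - a\<^sup>2 = 2 * c * b - c\<^sup>2 - a\<^sup>2 + (b - c)\<^sup>2"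
    by (simp_all add: power2_eq_square algebra_simps)
  then have "min (2 * (b - a) * c) (b\<^sup>2 - a\<^sup>2)
      = 2 * c * b - c\<^sup>2 - a\<^sup>2 + min ((c - a)\<^sup>2) ((b - c)\<^sup>2)"
    by (simp add: min_add_distrib_right)
  moreover have "min ((c - a)\<^sup>2) ((b - c)\<^sup>2) \<le> ((b - a) / 2)\<^sup>2"
  proof (cases "c - a \<le> (b - a) / 2")
    case True
    then have "(c - a)\<^sup>2 \<le> ((b - a) / 2)\<^sup>2" using assms by (intro power_mono) auto
    then show ?thesis by simp
  next
    case False
    then have "(b - c)\<^sup>2 \<le> ((b - a) / 2)\<^sup>2"
      using assms by (intro power_mono) (auto simp: field_simps)
    then show ?thesis by simp
  qed
  ultimately show ?thesis unfolding * k by auto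
qed

lemma tangent_sum_ge:
  assumes "mono z"
  shows "kink_integral c (z m) - kink_integral c (z 0) \<le> tangent_sum z m c"
proof -
  have "kink_integral c (z m) - kink_integral c (z 0)
      = (\<Sum>j<m. kink_integral c (z (Suc j)) - kink_integral c (z j))"
    by (simp add: sum_lessThan_telescope[of "\<lambda>j. kink_integral c (z j)"])
  also have "\<dots> \<le> tangent_sum z m c"
    unfolding tangent_sum_def using assms by (intro sum_mono midpoint_rule_ge) (simp add: monoD)
  finally show ?thesis .
qed

lemma tangent_sum_le:
  assumes "mono z" "0 \<le> E"
    and E: "\<And>j. z j \<le> c \<Longrightarrow> c < z (Suc j) \<Longrightarrow>
      min ((c - z j)\<^sup>2) (((z (Suc j) - z j) / 2)\<^sup>2) \<le> E"
  shows "tangent_sum z m c \<le> kink_integral c (z m) - kink_integral c (z 0) + E"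
proof -
  \<comment> \<open>At most one cell contains \<open>c\<close>, so \<open>E\<close> is paid at most
    once. The induction claim is strengthened to charge nothing until the grid has passed
    \<open>c\<close>.\<close>
  have "tangent_sum z m c
      \<le> kink_integral c (z m) - kink_integral c (z 0) + (if z m \<le> c then 0 else E)"
  proof (induction m)
    case 0
    show ?case using assms by (simp add: tangent_sum_def)
  next
    case (Suc m)
    have le: "z m \<le> z (Suc m)" using assms(1) by (simp add: monoD)
    have step: "tangent_sum z (Suc m) c = tangent_sum z m c
        + 2 * (z (Suc m) - z m) * min c ((z m + z (Suc m)) / 2)"
      by (simp add: tangent_sum_def)
    show ?case
    proof (cases "z m \<le> c \<and> c < z (Suc m)")
      case True
      then show ?thesis
        using Suc E[of m] midpoint_rule_le[of "z m" c "z (Suc m)"] unfolding step by auto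
    next
      case False
      then have *: "z (Suc m) \<le> c \<or> c < z m" by auto
      have "tangent_sum z (Suc m) c
          = tangent_sum z m c + (kink_integral c (z (Suc m)) - kink_integral c (z m))"
        unfolding step midpoint_rule_exact[OF le *] ..
      then show ?thesis using Suc le * by (auto split: if_splits)
    qed
  qed
  then show ?thesis using assms(2) by (auto split: if_splits)
qed

section \<open>Relative error on a quadratically spaced grid\<close>

definition quadratic_grid :: "real \<Rightarrow> nat \<Rightarrow> nat \<Rightarrow> real" where
  "quadratic_grid n m j = n / 2 * (real j / real m)\<^sup>2"

lemma mono_quadratic_grid: "0 \<le> n \<Longrightarrow> mono (quadratic_grid n m)"
  unfolding quadratic_grid_def
  by (intro monoI mult_left_mono power_mono divide_right_mono) auto

text \<open>Since \<open>n - c \<ge> n / 2\<close>, an error of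
  \<open>\<epsilon> * (c * (n / 2))\<close> is allowed. Beyond the first cell, the squared width of
  a quadratic cell is of the order of its left endpoint times \<open>n / m^2\<close>, which fits
  this allowance; the first cell has left endpoint 0 and is treated through the distance to
  0.\<close>

lemma quadratic_grid_error:
  assumes n: "0 < n" and m: "0 < m" and eps: "9 / 4 \<le> \<epsilon> * (real m)\<^sup>2"
    and c: "c \<le> n / 2" "quadratic_grid n m j \<le> c" "c < quadratic_grid n m (Suc j)"
  shows "min ((c - quadratic_grid n m j)\<^sup>2)
      (((quadratic_grid n m (Suc j) - quadratic_grid n m j) / 2)\<^sup>2) \<le> \<epsilon> * (c * (n - c))"
proof -
  have M: "(real m)\<^sup>2 > 0" using m by simp
  then have eps0: "\<epsilon> > 0" using less_le_trans[OF _ eps, of 0] by (simp add: zero_less_mult_iff)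
  have "0 \<le> quadratic_grid n m j" using n by (simp add: quadratic_grid_def)
  then have c0: "0 \<le> c" using c(2) by linarith
  have "\<epsilon> * (c * (n / 2)) \<le> \<epsilon> * (c * (n - c))"
    using eps0 c0 c by (intro mult_left_mono) auto
  moreover have "min ((c - quadratic_grid n m j)\<^sup>2)
      (((quadratic_grid n m (Suc j) - quadratic_grid n m j) / 2)\<^sup>2) \<le> \<epsilon> * (c * (n / 2))"
  proof (cases j)
    case 0
    \<comment> \<open>The first cell ends at \<open>n / (2 * m^2)\<close>, so one factor of
      \<open>c * c\<close> is at most \<open>n / 2 * \<epsilon>\<close>.\<close>
    have "1 / (real m)\<^sup>2 \<le> \<epsilon>" using eps M by (simp add: field_simps)
    then have "n / 2 * (1 / (real m)\<^sup>2) \<le> n / 2 * \<epsilon>"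
      using n by (intro mult_left_mono) auto
    then have "c \<le> n / 2 * \<epsilon>"
      using c(3) 0 by (simp add: quadratic_grid_def power_divide)
    then have "c * c \<le> c * (n / 2 * \<epsilon>)" using c0 by (intro mult_left_mono)
    then have "c\<^sup>2 \<le> \<epsilon> * (c * (n / 2))" by (simp add: power2_eq_square mult_ac)
    then show ?thesis using 0 by (simp add: quadratic_grid_def min.coboundedI1)
  next
    case (Suc i)
    define J where "J = real j"
    define M2 where "M2 = (real m)\<^sup>2"
    have J: "J \<ge> 1" using Suc by (simp add: J_def)
    have a: "quadratic_grid n m j = n / 2 * J\<^sup>2 / M2"
      by (simp add: quadratic_grid_def J_def M2_def power_divide)
    have "quadratic_grid n m (Suc j) - quadratic_grid n m j = n / 2 * (2 * J + 1) / M2"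
      using m by (simp add: quadratic_grid_def J_def M2_def power2_eq_square field_simps)
    then have "((quadratic_grid n m (Suc j) - quadratic_grid n m j) / 2)\<^sup>2
        = (n / 4)\<^sup>2 * (2 * J + 1)\<^sup>2 / M2\<^sup>2"
      by (simp add: power_divide power_mult_distrib)
    \<comment> \<open>The bound \<open>2 * J + 1 \<le> 3 * J\<close> for \<open>J \<ge> 1\<close> is
      the source of the constant \<open>9 / 4\<close> in the hypothesis on
      \<open>\<epsilon>\<close>.\<close>
    also have "\<dots> \<le> (n / 4)\<^sup>2 * (3 * J)\<^sup>2 / M2\<^sup>2"
      using J by (intro divide_right_mono mult_left_mono power_mono) auto
    also have "\<dots> = n\<^sup>2 / 4 * J\<^sup>2 / M2\<^sup>2 * (9 / 4)"
      by (simp add: power2_eq_square)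
    also have "\<dots> \<le> n\<^sup>2 / 4 * J\<^sup>2 / M2\<^sup>2 * (\<epsilon> * M2)"
      using eps by (intro mult_left_mono) (auto simp: M2_def)
    also have "\<dots> = \<epsilon> * (quadratic_grid n m j * (n / 2))"
      using M unfolding a M2_def[symmetric] by (simp add: power2_eq_square)
    also have "\<dots> \<le> \<epsilon> * (c * (n / 2))"
      using eps0 n c by (intro mult_left_mono mult_right_mono) auto
    finally show ?thesis by (simp add: min.coboundedI2)
  qed
  ultimately show ?thesis by linarith
qed

lemma tangent_sum_quadratic_grid:
  assumes "0 < n" "0 < m" "9 / 4 \<le> \<epsilon> * (real m)\<^sup>2" "0 \<le> c" "c \<le> n / 2"
  shows "c * (n - c) \<le> tangent_sum (quadratic_grid n m) m c"
    and "tangent_sum (quadratic_grid n m) m c \<le> (1 + \<epsilon>) * (c * (n - c))"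
proof -
  let ?z = "quadratic_grid n m"
  have z: "?z m = n / 2" "?z 0 = 0" using assms by (auto simp: quadratic_grid_def)
  \<comment> \<open>The target parabola is itself the exact integral:
    \<open>2 * c * (n / 2) - c^2 = c * (n - c)\<close>.\<close>
  have "kink_integral c (n / 2) = c * (n - c)"
    using assms by (auto simp: kink_integral_def power2_eq_square algebra_simps)
  moreover have "kink_integral c 0 = 0" using assms by (simp add: kink_integral_def)
  ultimately have k: "kink_integral c (?z m) - kink_integral c (?z 0) = c * (n - c)"
    unfolding z by simp
  have mono: "mono ?z" using assms by (simp add: mono_quadratic_grid)
  show "c * (n - c) \<le> tangent_sum ?z m c" using tangent_sum_ge[OF mono, of c m] k by simp
  have "0 \<le> \<epsilon>" using less_le_trans[OF _ assms(3), of 0] by (simp add: zero_less_mult_iff)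
  then have "0 \<le> \<epsilon> * (c * (n - c))" using assms by simp
  then have "tangent_sum ?z m c
      \<le> kink_integral c (?z m) - kink_integral c (?z 0) + \<epsilon> * (c * (n - c))"
    by (rule tangent_sum_le[OF mono]) (rule quadratic_grid_error[OF assms(1-3,5)])
  then show "tangent_sum ?z m c \<le> (1 + \<epsilon>) * (c * (n - c))"
    unfolding k by (simp only: distrib_right mult_1)
qed

section \<open>Sparsifiers of the complete graph\<close>

lemma complete_digraph_self_sparsifier:
  assumes G: "complete_digraph n (with_proj G)" and "0 \<le> \<epsilon>"
  shows "\<exists>H w. augmented_cut_sparsifier \<epsilon> G {} H w \<and> card (pverts H) = n \<and> card (parcs H) \<le> n * n"
proof -
  from G have G': "finite (pverts G)" "card (pverts G) = n"
    "parcs G = {(u,v). (u,v) \<in> pverts G \<times> pverts G \<and> u \<noteq> v}"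
    by (auto simp: complete_digraph_pair_def)
  define H :: "('a + nat) pair_pre_digraph" where
    "H = \<lparr> pverts = pverts G <+> {}, parcs = map_prod Inl Inl ` parcs G \<rparr>"
  have sub: "parcs G \<subseteq> pverts G \<times> pverts G" using G' by auto
  then have fin: "finite (parcs G)" using G' by (meson finite_SigmaI finite_subset)
  have "card (parcs H) \<le> card (parcs G)"
    using fin by (simp add: H_def card_image_le)
  also have "\<dots> \<le> n * n"
    using card_mono[OF _ sub] G' by (simp add: card_cartesian_product)
  finally have card: "card (parcs H) \<le> n * n" .
  have loopfree: "fst e \<noteq> snd e" if "e \<in> parcs G" for e
    using that G'(3) by auto
  have dg: "pair_digraph H"
  proof
    fix e assume "e \<in> parcs H"
    then obtain d where d: "e = map_prod Inl Inl d" "d \<in> parcs G" by (auto simp: H_def)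
    then have "fst d \<in> pverts G" "snd d \<in> pverts G" using sub by auto
    then show "fst e \<in> pverts H" "snd e \<in> pverts H" "fst e \<noteq> snd e"
      using d loopfree by (simp_all add: H_def InlI)
  qed (use G'(1) fin in \<open>simp_all add: H_def\<close>)
  \<comment> \<open>Only the empty \<open>T\<close> is available, and of the two arcs of each
    crossing edge exactly one leaves \<open>S\<close>.\<close>
  have "augmented_cut {} H (\<lambda>_. 1) S = real (undirected_cut G S)" if S: "S \<subseteq> pverts G" for S
  proof -
    have "{e \<in> parcs H. fst e \<in> S <+> {} \<and> snd e \<notin> S <+> {}}
        = map_prod Inl Inl ` (S \<times> (pverts G - S))"
      using S by (auto simp: H_def G'(3))
    moreover have "card (map_prod Inl Inl ` (S \<times> (pverts G - S)) :: (('a + nat) \<times> ('a + nat)) set)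
        = card (S \<times> (pverts G - S))"
      by (intro card_image) (auto simp: inj_on_def)
    ultimately show ?thesis
      using S G' by (simp add: augmented_cut_def dircut_def undirected_cut_complete_digraph[OF G S]
          card_cartesian_product card_Diff_subset finite_subset)
  qed
  then have "augmented_cut_sparsifier \<epsilon> G {} H (\<lambda>_. 1)"
    using dg \<open>0 \<le> \<epsilon>\<close> by (simp add: augmented_cut_sparsifier_def mult_le_cancel_right1)
      (simp add: H_def)
  moreover have "card (pverts H) = n" using G' by (simp add: H_def card_Plus)
  ultimately show ?thesis using card by blast
qed

lemma complete_digraph_star_sparsifier:
  assumes G: "complete_digraph n (with_proj G)" and "0 < n" "0 < m" "9 / 4 \<le> \<epsilon> * (real m)\<^sup>2"
  shows "\<exists>w. augmented_cut_sparsifier \<epsilon> G {..<2 * m} (star_digraph (pverts G) {..<2 * m}) w"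
proof -
  from G have G': "finite (pverts G)" "card (pverts G) = n"
    by (auto simp: complete_digraph_pair_def)
  define z where "z = quadratic_grid n m"
  define s where "s j = (z j + z (Suc j)) / 2" for j
  \<comment> \<open>The divisor \<open>n\<close> cancels the factor \<open>n\<close> produced by
    \<open>min_mirrored_tents\<close>.\<close>
  define a where "a j = 2 * (z (Suc j) - z j) / n" for j
  \<comment> \<open>The auxiliary nodes \<open>2 * j\<close> and \<open>2 * j + 1\<close> form the
    mirrored pair with kink \<open>s j\<close>.\<close>
  define \<alpha> where "\<alpha> i = a (i div 2) * (if even i then n - s (i div 2) else s (i div 2))" for i
  define \<beta> where "\<beta> i = a (i div 2) * (if even i then s (i div 2) else n - s (i div 2))" for i
  have mono: "mono z" unfolding z_def by (simp add: mono_quadratic_grid)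
  have z0: "0 \<le> z j" for j by (simp add: z_def quadratic_grid_def)
  have a0: "0 \<le> a j" for j using mono by (simp add: a_def monoD)
  have zm: "z j \<le> n / 2" if "j \<le> m" for j
    using monoD[OF mono that] \<open>0 < m\<close> by (simp add: z_def quadratic_grid_def)
  have s: "0 \<le> s j" "j < m \<Longrightarrow> s j \<le> n / 2" for j
    using z0[of j] z0[of "Suc j"] zm[of j] zm[of "Suc j"] by (auto simp: s_def)
  have nonneg: "0 \<le> \<alpha> i \<and> 0 \<le> \<beta> i" if "i < 2 * m" for i
  proof -
    have "i div 2 < m" using that by simp
    then have "0 \<le> n - s (i div 2)" using s[of "i div 2"] by auto
    then show ?thesis using s(1)[of "i div 2"] a0[of "i div 2"] by (auto simp: \<alpha>_def \<beta>_def)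
  qed
  have cut: "augmented_cut {..<2 * m} (star_digraph (pverts G) {..<2 * m}) (star_weight \<alpha> \<beta>) S
      = tangent_sum z m (min (real (card S)) (real n - real (card S)))"
    if S: "S \<subseteq> pverts G" for S
  proof -
    define k where "k = real (card S)"
    have "card S \<le> n" using S G' card_mono by blast
    then have k: "0 \<le> k" "k \<le> n" "real (card (pverts G - S)) = n - k"
      using S G' by (auto simp: k_def card_Diff_subset finite_subset of_nat_diff)
    have "augmented_cut {..<2 * m} (star_digraph (pverts G) {..<2 * m}) (star_weight \<alpha> \<beta>) S
        = (\<Sum>i<2 * m. min (\<alpha> i * k) (\<beta> i * (n - k)))"
      using S G' k by (simp add: augmented_cut_star_digraph k_def)
    also have "\<dots> = (\<Sum>j<m. min (\<alpha> (2 * j) * k) (\<beta> (2 * j) * (n - k)))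
        + (\<Sum>j<m. min (\<alpha> (2 * j + 1) * k) (\<beta> (2 * j + 1) * (n - k)))"
      by (subst sum_split_even_odd[symmetric]) simp
    also have "\<dots> = (\<Sum>j<m. a j * (min ((n - s j) * k) (s j * (n - k))
        + min (s j * k) ((n - s j) * (n - k))))"
      using a0 by (simp add: \<alpha>_def \<beta>_def min_mult_distrib_left mult.assoc distrib_left
            sum.distrib)
    also have "\<dots> = (\<Sum>j<m. a j * (n * min (min k (n - k)) (s j)))"
      using k s by (intro sum.cong) (auto simp: min_mirrored_tents)
    also have "\<dots> = tangent_sum z m (min k (n - k))"
      using \<open>0 < n\<close> by (simp add: tangent_sum_def a_def s_def)
    finally show ?thesis by (simp add: k_def)
  qed
  have "real (undirected_cut G S)
        \<le> augmented_cut {..<2 * m} (star_digraph (pverts G) {..<2 * m}) (star_weight \<alpha> \<beta>) S \<and>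
      augmented_cut {..<2 * m} (star_digraph (pverts G) {..<2 * m}) (star_weight \<alpha> \<beta>) S
        \<le> (1 + \<epsilon>) * real (undirected_cut G S)"
    if S: "S \<subseteq> pverts G" for S
  proof -
    define c where "c = min (real (card S)) (real n - real (card S))"
    have le: "card S \<le> n" using S G' card_mono by blast
    then have "0 \<le> c" "c \<le> n / 2" by (auto simp: c_def min_def)
    moreover have "real (undirected_cut G S) = c * (n - c)"
      using le by (auto simp: undirected_cut_complete_digraph[OF G S] c_def min_def of_nat_diff)
    ultimately show ?thesis
      using cut[OF S] tangent_sum_quadratic_grid[of n m \<epsilon> c] assms unfolding c_def z_def by simp
  qed
  moreover have "\<forall>e\<in>parcs (star_digraph (pverts G) {..<2 * m}). 0 \<le> star_weight \<alpha> \<beta> e"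
    using nonneg by (auto simp: star_digraph_def star_weight_def)
  ultimately show ?thesis
    using G' by (intro exI[of _ "star_weight \<alpha> \<beta>"])
      (simp add: augmented_cut_sparsifier_def pair_digraph_star_digraph, simp add: star_digraph_def)
qed

lemma complete_digraph_sparsifier:
  assumes G: "complete_digraph n (with_proj G)" and "0 < m" "9 / 4 \<le> \<epsilon> * (real m)\<^sup>2"
  shows "\<exists>A H w. augmented_cut_sparsifier \<epsilon> G A H w \<and> card (pverts H) \<le> 3 * n
    \<and> card (parcs H) \<le> 4 * n * m"
\<comment> \<open>For \<open>m \<le> n\<close> the star has \<open>n + 2 * m \<le> 3 * n\<close>
  nodes; here \<open>0 < m\<close> forces \<open>0 < n\<close>. Otherwise, which includes
  \<open>n = 0\<close>, the \<open>n * n\<close> bound on the arcs of the complete graph is below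
  \<open>4 * n * m\<close>.\<close>
proof (cases "m \<le> n")
  case True
  have G': "finite (pverts G)" "card (pverts G) = n"
    using G by (auto simp: complete_digraph_pair_def)
  obtain w where
    "augmented_cut_sparsifier \<epsilon> G {..<2 * m} (star_digraph (pverts G) {..<2 * m}) w"
    using complete_digraph_star_sparsifier[OF G _ assms(2,3)] True \<open>0 < m\<close> by auto
  moreover have "card (pverts (star_digraph (pverts G) {..<2 * m})) \<le> 3 * n"
    using True G' by (simp add: card_pverts_star_digraph)
  moreover have "card (parcs (star_digraph (pverts G) {..<2 * m})) \<le> 4 * n * m"
    using G' by (simp add: card_parcs_star_digraph)
  ultimately show ?thesis by blast
next
  case False
  have "0 \<le> \<epsilon>" using less_le_trans[OF _ assms(3), of 0] by (simp add: zero_less_mult_iff)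
  then obtain H w where "augmented_cut_sparsifier \<epsilon> G {} H w" "card (pverts H) = n"
    "card (parcs H) \<le> n * n"
    using complete_digraph_self_sparsifier[OF G] by blast
  moreover have "n * n \<le> 4 * n * m"
    using mult_le_mono[of n "4 * n" n m] False by simp
  ultimately have "augmented_cut_sparsifier \<epsilon> G {} H w \<and> card (pverts H) \<le> 3 * n
      \<and> card (parcs H) \<le> 4 * n * m"
    by linarith
  then show ?thesis by blast
qed

section \<open>Choice of the grid size and of the constants\<close>

theorem theorem3:
  shows "\<exists>(C\<^sub>1::real) (C\<^sub>2::real) (\<epsilon>\<^sub>0::real). 0 < \<epsilon>\<^sub>0 \<and>
    (\<forall>(\<epsilon>::real) (n::nat) (G :: 'a pair_pre_digraph).
       0 < \<epsilon> \<longrightarrow> complete_digraph n (with_proj G) \<longrightarrow>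
       (\<exists>A H w. augmented_cut_sparsifier \<epsilon> G A H w \<and>
          real (card (pverts H)) \<le> C\<^sub>1 * real n \<and>
          (\<epsilon> < \<epsilon>\<^sub>0 \<longrightarrow>
             real (card (parcs H)) \<le> C\<^sub>2 * (real n * \<epsilon> powr (-1/2) * ln (ln (1 / \<epsilon>))))))"
\<comment> \<open>The 3 is the node bound, 10 is \<open>4 * (5 / 2)\<close> from
  \<open>4 * n * m\<close> with \<open>m \<le> 5 / 2 * q\<close>, and at
  \<open>exp (- exp 1)\<close> the double logarithm equals 1, so below it this factor can only
  enlarge the bound.\<close>
proof (rule exI[of _ 3], rule exI[of _ 10], rule exI[of _ "exp (- exp 1)"], intro conjI allI impI)
  show "0 < exp (- exp 1 :: real)" by simp
next
  fix \<epsilon> :: real and n :: nat and G :: "'a pair_pre_digraph"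
  assume \<epsilon>: "0 < \<epsilon>" and G: "complete_digraph n (with_proj G)"
  define q where "q = \<epsilon> powr (-1/2)"
  have q: "0 < q" "\<epsilon> * q\<^sup>2 = 1"
    using \<epsilon> by (simp_all add: q_def powr_minus powr_half_sqrt power_inverse)
  \<comment> \<open>The least \<open>m\<close> with
    \<open>9 / 4 \<le> \<epsilon> * m^2\<close>.\<close>
  define m where "m = nat \<lceil>3 / 2 * q\<rceil>"
  have m: "3 / 2 * q \<le> m" "m \<le> 3 / 2 * q + 1" "0 < m"
    using q(1) by (auto simp: m_def of_nat_ceiling)
  have "9 / 4 = \<epsilon> * (3 / 2 * q)\<^sup>2" using q(2) by (simp add: power_mult_distrib power2_eq_square)
  also have "\<dots> \<le> \<epsilon> * (real m)\<^sup>2" using \<epsilon> m q by (intro mult_left_mono power_mono) auto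
  finally obtain A H w where H: "augmented_cut_sparsifier \<epsilon> G A H w" "card (pverts H) \<le> 3 * n"
    "card (parcs H) \<le> 4 * n * m"
    using complete_digraph_sparsifier[OF G \<open>0 < m\<close>] by blast
  have "real (card (parcs H)) \<le> 10 * (real n * \<epsilon> powr (-1/2) * ln (ln (1 / \<epsilon>)))"
    if small: "\<epsilon> < exp (- exp 1)"
  proof -
    have "ln \<epsilon> < - exp 1" using small \<epsilon> by (metis exp_ln exp_less_cancel_iff)
    then have "exp 1 < ln (1 / \<epsilon>)" using \<epsilon> by (simp add: ln_div)
    then have loglog: "1 \<le> ln (ln (1 / \<epsilon>))"
      by (metis exp_gt_zero less_trans ln_exp ln_less_cancel_iff less_imp_le)
    \<comment> \<open>This yields \<open>1 \<le> q\<close>, which absorbs the rounding term: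
      \<open>3 / 2 * q + 1 \<le> 5 / 2 * q\<close>.\<close>
    have "\<epsilon> < 1" by (rule less_trans[OF small]) simp
    then have "\<epsilon> * q\<^sup>2 \<le> 1 * q\<^sup>2" by (intro mult_right_mono) auto
    then have "1 \<le> q" using q by (simp add: power2_nonneg_ge_1_iff)
    have "real (card (parcs H)) \<le> real (4 * n * m)" using H(3) by (simp only: of_nat_le_iff)
    also have "\<dots> = 4 * real n * real m" by simp
    also have "\<dots> \<le> 4 * real n * (5 / 2 * q)"
      using m \<open>1 \<le> q\<close> by (intro mult_left_mono) auto
    also have "\<dots> = 10 * (real n * q * 1)" by simp
    also have "\<dots> \<le> 10 * (real n * q * ln (ln (1 / \<epsilon>)))"
      using q loglog by (intro mult_left_mono) auto
    finally show ?thesis by (simp add: q_def)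
  qed
  moreover have "real (card (pverts H)) \<le> 3 * real n" using H(2) by linarith
  ultimately show "\<exists>A H w. augmented_cut_sparsifier \<epsilon> G A H w \<and>
      real (card (pverts H)) \<le> 3 * real n \<and>
      (\<epsilon> < exp (- exp 1) \<longrightarrow>
        real (card (parcs H)) \<le> 10 * (real n * \<epsilon> powr (-1/2) * ln (ln (1 / \<epsilon>))))"
    using H(1) by blast
qed

end
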